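(* Under the setting of the following data: $m\ge1$, $\tau>0$, symmetric $\Sigma_z\succ0$ in $\mathbb{R}^{m\times m}$, $M\in\mathbb{R}^{m\times N}$ of full row rank, block-diagonal $D^{(\ell)}=\mathrm{diag}_{j\in\mathcal{N}_i}[\Sigma^{(\ell)}_{\alpha_j}]$, $\ell\in\{a,b\}$, with symmetric blocks satisfying $\Sigma^{(a)}_{\alpha_j}\succ\Sigma^{(b)}_{\alpha_j}\succ0$ for all $j$, $\Sigma_p^{(\ell)}=MD^{(\ell)}M^T$ each commuting with $\Sigma_z^{-1}$, and $P_f^{u(\ell)}=\mathbb{P}\big((z^{(\ell)})^T\Sigma_z^{-1}z^{(\ell)}>\tau\big)$ for $z^{(\ell)}\sim\mathcal{N}(0,\Sigma_z+\Sigma_p^{(\ell)})$, it holds that $P_f^{u(a)}>P_f^{u(b)}$.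
   Context: $X\succ Y$ means $X-Y$ is positive definite. In the paper $M=C_iE_i$ and $P_f^{u(\ell)}$ is the false-alarm probability of subsystem $i$'s detector that ignores the neighbors' privacy-noise covariances $\Sigma^{(\ell)}_{\alpha_j}$. *)

theory Defs
  imports "HOL-Analysis.Analysis"
begin

text \<open>Positive definiteness (no symmetry built in; symmetry is assumed separately).\<close>
definition pos_def :: "real^'n^'n \<Rightarrow> bool" where
  "pos_def A \<longleftrightarrow> (\<forall>x::real^'n. x \<noteq> 0 \<longrightarrow> x \<bullet> (A *v x) > 0)"

text \<open>Loewner strict order: X \<succ> Y iff X - Y is positive definite.\<close>
definition succ_mat :: "real^'n^'n \<Rightarrow> real^'n^'n \<Rightarrow> bool" where
  "succ_mat X Y \<longleftrightarrow> pos_def (X - Y)"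

definition symmetric_mat :: "real^'n^'n \<Rightarrow> bool" where
  "symmetric_mat A \<longleftrightarrow> transpose A = A"

text \<open>Block structure: coordinate p of R^N belongs to block blk p (a neighbour j).
  D is block diagonal iff entries between different blocks vanish.\<close>
definition block_diag :: "('n \<Rightarrow> 'k) \<Rightarrow> real^'n^'n \<Rightarrow> bool" where
  "block_diag blk D \<longleftrightarrow> (\<forall>p q. blk p \<noteq> blk q \<longrightarrow> D $ p $ q = 0)"

text \<open>The j-th diagonal block of D is symmetric.\<close>
definition block_symmetric :: "('n \<Rightarrow> 'k) \<Rightarrow> 'k \<Rightarrow> real^'n^'n \<Rightarrow> bool" where
  "block_symmetric blk j D \<longleftrightarrow> (\<forall>p q. blk p = j \<longrightarrow> blk q = j \<longrightarrow> D $ p $ q = D $ q $ p)"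

text \<open>The j-th diagonal block of A is positive definite (quadratic form on vectors
  supported in block j).\<close>
definition block_pos_def :: "('n \<Rightarrow> 'k) \<Rightarrow> 'k \<Rightarrow> real^'n^'n \<Rightarrow> bool" where
  "block_pos_def blk j A \<longleftrightarrow>
     (\<forall>x::real^'n. x \<noteq> 0 \<longrightarrow> (\<forall>p. blk p \<noteq> j \<longrightarrow> x $ p = 0) \<longrightarrow> x \<bullet> (A *v x) > 0)"

text \<open>Density of the centered Gaussian N(0,S) on R^m.\<close>
definition gaussian_density :: "real^'m^'m \<Rightarrow> real^'m \<Rightarrow> real" where
  "gaussian_density S x =
     exp (- (x \<bullet> (matrix_inv S *v x)) / 2) / sqrt ((2 * pi) ^ CARD('m) * det S)"

definition gaussian_measure :: "real^'m^'m \<Rightarrow> (real^'m) measure" where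
  "gaussian_measure S = density lborel (\<lambda>x. ennreal (gaussian_density S x))"

text \<open>Unaware false-alarm probability: P(z^T Sz^{-1} z > tau), z ~ N(0, Sz + Sp).\<close>
definition false_alarm_unaware :: "real^'m^'m \<Rightarrow> real^'m^'m \<Rightarrow> real \<Rightarrow> real" where
  "false_alarm_unaware Sz Sp \<tau> =
     measure (gaussian_measure (Sz + Sp)) {z. z \<bullet> (matrix_inv Sz *v z) > \<tau>}"

end

theory Submission
  imports Defs "HOL-Probability.Probability"
begin

text \<open>Write \<open>\<Sigma>\<^sub>z = W\<^sup>2\<close> with \<open>W\<close> symmetric positive definite and let \<open>R\<close> be the symmetric
  square root of \<open>T = W\<inverse> (\<Sigma>\<^sub>z + \<Sigma>\<^sub>p) W\<inverse>\<close>. The linear map \<open>u \<mapsto> W R u\<close> pushes the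
  standard Gaussian forward to \<open>N(0, \<Sigma>\<^sub>z + \<Sigma>\<^sub>p)\<close> and turns the statistic \<open>z\<^sup>T \<Sigma>\<^sub>z\<inverse> z\<close>
  into \<open>u\<^sup>T T u\<close>, so the false-alarm probability is the standard Gaussian probability of
  \<open>u\<^sup>T T u > \<tau>\<close>. As \<open>M\<^sup>T\<close> is injective, \<open>D\<^sup>a \<succ> D\<^sup>b\<close> gives \<open>T\<^sup>a \<succ> T\<^sup>b\<close>: the event for \<open>b\<close>
  lies inside the event for \<open>a\<close>, and their difference contains a nonempty open set, which
  has positive Gaussian measure.\<close>

section \<open>Inverses and quadratic forms\<close>

lemma matrix_inv_right:
  fixes A :: "'a::semiring_1^'n^'m"
  assumes "invertible A"
  shows "A ** matrix_inv A = mat 1"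
  using someI_ex[OF assms[unfolded invertible_def]] unfolding matrix_inv_def by blast

lemma matrix_inv_left:
  fixes A :: "'a::semiring_1^'n^'m"
  assumes "invertible A"
  shows "matrix_inv A ** A = mat 1"
  using someI_ex[OF assms[unfolded invertible_def]] unfolding matrix_inv_def by blast

lemma invertible_matrix_inv:
  fixes A :: "'a::semiring_1^'n^'m"
  assumes "invertible A"
  shows "invertible (matrix_inv A)"
  using matrix_inv_left[OF assms] matrix_inv_right[OF assms] invertible_def by blast

lemma matrix_inv_unique:
  fixes A B :: "'a::comm_semiring_1^'n^'n"
  assumes "A ** B = mat 1" and "B ** A = mat 1"
  shows "matrix_inv A = B"
proof -
  have "invertible A"
    using assms invertible_def by blast
  have "matrix_inv A = matrix_inv A ** (A ** B)"
    by (simp add: assms(1))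
  also have "\<dots> = B"
    by (simp add: matrix_mul_assoc matrix_inv_left \<open>invertible A\<close>)
  finally show ?thesis .
qed

lemma matrix_inv_mult:
  fixes A B :: "'a::comm_semiring_1^'n^'n"
  assumes "invertible A" and "invertible B"
  shows "matrix_inv (A ** B) = matrix_inv B ** matrix_inv A"
proof (rule matrix_inv_unique)
  have "A ** B ** (matrix_inv B ** matrix_inv A) = A ** (B ** matrix_inv B) ** matrix_inv A"
    by (simp only: matrix_mul_assoc)
  then show "A ** B ** (matrix_inv B ** matrix_inv A) = mat 1"
    by (simp add: matrix_inv_right assms)
  have "matrix_inv B ** matrix_inv A ** (A ** B) = matrix_inv B ** (matrix_inv A ** A) ** B"
    by (simp only: matrix_mul_assoc)
  then show "matrix_inv B ** matrix_inv A ** (A ** B) = mat 1"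
    by (simp add: matrix_inv_left assms)
qed

lemma transpose_matrix_inv:
  fixes A :: "'a::comm_semiring_1^'n^'n"
  assumes "invertible A"
  shows "transpose (matrix_inv A) = matrix_inv (transpose A)"
  by (rule matrix_inv_unique[symmetric])
    (simp_all add: matrix_transpose_mul[symmetric] matrix_inv_left matrix_inv_right assms)

lemma matrix_inv_mat_1: "matrix_inv (mat 1 :: 'a::comm_semiring_1^'n^'n) = mat 1"
  by (rule matrix_inv_unique) simp_all

lemma inner_transpose_matrix_vector:
  fixes A :: "real^'n^'m"
  shows "x \<bullet> (transpose A *v y) = (A *v x) \<bullet> y"
  by (metis dot_lmul_matrix inner_commute transpose_matrix_vector)

lemma inner_congruence_matrix_vector:
  fixes A :: "real^'n^'m" and S :: "real^'m^'m"
  shows "u \<bullet> ((transpose A ** S ** A) *v u) = (A *v u) \<bullet> (S *v (A *v u))"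
  by (simp only: matrix_vector_mul_assoc[symmetric] inner_transpose_matrix_vector)

lemma symmetric_mat_inner_commute:
  fixes S :: "real^'n^'n"
  assumes "symmetric_mat S"
  shows "x \<bullet> (S *v y) = (S *v x) \<bullet> y"
  using inner_transpose_matrix_vector[of x S y] assms by (metis symmetric_mat_def)

lemma symmetric_matI:
  fixes R :: "real^'n^'n"
  assumes "\<And>x y. (R *v x) \<bullet> y = x \<bullet> (R *v y)"
  shows "symmetric_mat R"
proof -
  have "transpose R *v x = R *v x" for x
    using assms inner_transpose_matrix_vector[of _ R x]
    by (metis inner_commute vector_eq_rdot)
  then show ?thesis
    by (simp add: symmetric_mat_def matrix_eq)
qed

lemma symmetric_mat_congruence:
  assumes "symmetric_mat S"
  shows "symmetric_mat (transpose A ** S ** A)"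
  using assms by (simp add: symmetric_mat_def matrix_transpose_mul matrix_mul_assoc)

lemma pos_def_congruence:
  fixes A :: "real^'n^'m" and S :: "real^'m^'m"
  assumes "pos_def S" and "inj ((*v) A)"
  shows "pos_def (transpose A ** S ** A)"
  unfolding pos_def_def inner_congruence_matrix_vector
proof (intro allI impI)
  fix u :: "real^'n"
  assume "u \<noteq> 0"
  then have "A *v u \<noteq> 0"
    using \<open>inj ((*v) A)\<close> by (metis injD matrix_vector_mult_0_right)
  then show "(A *v u) \<bullet> (S *v (A *v u)) > 0"
    using assms(1) by (simp add: pos_def_def)
qed

lemma pos_def_add:
  assumes "pos_def A" and "pos_def B"
  shows "pos_def (A + B)"
  using assms by (simp add: pos_def_def matrix_vector_mult_add_rdistrib inner_add_right add_pos_pos)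

lemma pos_def_imp_invertible:
  fixes R :: "real^'n^'n"
  assumes "pos_def R"
  shows "invertible R"
proof -
  have "inj ((*v) R)"
  proof (rule injI)
    fix x y
    assume "R *v x = R *v y"
    then have "(x - y) \<bullet> (R *v (x - y)) = 0"
      by (simp add: matrix_vector_mult_diff_distrib)
    then show "x = y"
      using assms unfolding pos_def_def by (metis less_irrefl right_minus_eq)
  qed
  then show ?thesis
    by (simp add: invertible_left_inverse matrix_left_invertible_injective)
qed

section \<open>Spectral theorem and square roots\<close>

lemma linear_coeff_eq_0_if_quadratic_nonpos:
  fixes c d :: real
  assumes "\<And>t. 2 * t * c + t\<^sup>2 * d \<le> 0"
  shows "c = 0"
proof -
  define k where "k = \<bar>d\<bar> + 1"
  have "k > 0" and "2 * k + d > 0"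
    by (auto simp: k_def)
  have "c\<^sup>2 * (2 * k + d) / k\<^sup>2 = 2 * (c / k) * c + (c / k)\<^sup>2 * d"
    using \<open>k > 0\<close> by (simp add: field_simps power2_eq_square)
  also have "\<dots> \<le> 0"
    by (rule assms)
  finally have "c\<^sup>2 * (2 * k + d) \<le> 0"
    using \<open>k > 0\<close> by (simp add: divide_le_0_iff)
  then have "c\<^sup>2 \<le> 0"
    using \<open>2 * k + d > 0\<close> by (simp add: mult_le_0_iff)
  then show ?thesis
    by simp
qed

lemma exists_rayleigh_maximizer:
  fixes S :: "real^'n^'n" and V :: "(real^'n) set"
  assumes "subspace V" and "closed V" and "a \<in> V" and "a \<noteq> 0"
  obtains v where "v \<in> V" and "norm v = 1" and "\<And>y. y \<in> V \<Longrightarrow> y \<bullet> (S *v y) \<le> (v \<bullet> (S *v v)) * (y \<bullet> y)"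
proof -
  have "compact (V \<inter> sphere 0 1)"
    using compact_Int_closed[OF compact_sphere assms(2), of 0 1] by (simp add: Int_commute)
  moreover have "a /\<^sub>R norm a \<in> V \<inter> sphere 0 1"
    using assms by (simp add: subspace_scale)
  moreover have "continuous_on (V \<inter> sphere 0 1) (\<lambda>x. x \<bullet> (S *v x))"
    by (intro continuous_intros)
  ultimately obtain v where "v \<in> V \<inter> sphere 0 1"
    and max: "\<And>y. y \<in> V \<inter> sphere 0 1 \<Longrightarrow> y \<bullet> (S *v y) \<le> v \<bullet> (S *v v)"
    using continuous_attains_sup[of "V \<inter> sphere 0 1" "\<lambda>x. x \<bullet> (S *v x)"] by blast
  then have "v \<in> V" and "norm v = 1"
    by auto
  have "y \<bullet> (S *v y) \<le> (v \<bullet> (S *v v)) * (y \<bullet> y)" if "y \<in> V" for y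
  proof (cases "y = 0")
    case False
    have "y /\<^sub>R norm y \<in> V \<inter> sphere 0 1"
      using \<open>subspace V\<close> that False by (simp add: subspace_scale)
    from max[OF this] have "(y \<bullet> (S *v y)) / (norm y)\<^sup>2 \<le> v \<bullet> (S *v v)"
      by (simp add: matrix_vector_mult_scaleR power2_eq_square divide_inverse mult.commute
          mult.left_commute)
    then show ?thesis
      using False by (simp add: divide_le_eq dot_square_norm)
  qed simp
  with that \<open>v \<in> V\<close> \<open>norm v = 1\<close> show ?thesis
    by blast
qed

lemma rayleigh_maximizer_eigenvector:
  fixes S :: "real^'n^'n" and V :: "(real^'n) set"
  assumes "symmetric_mat S" and "subspace V" and invariant: "\<And>x. x \<in> V \<Longrightarrow> S *v x \<in> V"
    and "v \<in> V" and "norm v = 1"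
    and rayleigh: "\<And>y. y \<in> V \<Longrightarrow> y \<bullet> (S *v y) \<le> (v \<bullet> (S *v v)) * (y \<bullet> y)"
  shows "S *v v = (v \<bullet> (S *v v)) *\<^sub>R v"
proof -
  define l where "l = v \<bullet> (S *v v)"
  have vv: "v \<bullet> v = 1"
    using \<open>norm v = 1\<close> by (simp add: dot_square_norm)
  define w where "w = S *v v - l *\<^sub>R v"
  have "w \<in> V"
    unfolding w_def using invariant[OF \<open>v \<in> V\<close>] \<open>v \<in> V\<close> \<open>subspace V\<close>
    by (simp add: subspace_diff subspace_scale)
  have wv: "w \<bullet> v = 0"
    unfolding w_def inner_diff_left inner_scaleR_left vv by (simp add: l_def inner_commute)
  have wSv: "w \<bullet> (S *v v) = w \<bullet> w" and vSw: "v \<bullet> (S *v w) = w \<bullet> w"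
    using wv symmetric_mat_inner_commute[OF assms(1), of v w]
    by (simp_all add: w_def inner_diff_right inner_diff_left inner_commute)
  \<comment> \<open>Perturbing \<open>v\<close> along \<open>w \<bottom> v\<close> keeps the Rayleigh bound only if the first-order term \<open>w \<bullet> w\<close> vanishes.\<close>
  have "2 * t * (w \<bullet> w) + t\<^sup>2 * (w \<bullet> (S *v w) - l * (w \<bullet> w)) \<le> 0" for t
  proof -
    have "v + t *\<^sub>R w \<in> V"
      using \<open>subspace V\<close> \<open>v \<in> V\<close> \<open>w \<in> V\<close> by (simp add: subspace_add subspace_scale)
    from rayleigh[OF this] show ?thesis
      using vv wv wSv vSw
      by (simp add: l_def power2_eq_square algebra_simps inner_commute[of w v])
  qed
  then have "w \<bullet> w = 0"
    by (rule linear_coeff_eq_0_if_quadratic_nonpos)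
  then show ?thesis
    by (simp add: w_def l_def)
qed

lemma symmetric_mat_eigenvector_orthogonal:
  fixes S :: "real^'n^'n" and B :: "(real^'n) set"
  assumes "symmetric_mat S"
    and eigen: "\<forall>b\<in>B. S *v b = (b \<bullet> (S *v b)) *\<^sub>R b"
    and "a \<noteq> 0" and "\<forall>b\<in>B. b \<bullet> a = 0"
  obtains v where "norm v = 1" and "\<forall>b\<in>B. b \<bullet> v = 0" and "S *v v = (v \<bullet> (S *v v)) *\<^sub>R v"
proof -
  define V where "V = {x. \<forall>b\<in>B. b \<bullet> x = 0}"
  have "subspace V"
    by (auto simp: V_def subspace_def inner_add_right)
  have "closed V"
    unfolding V_def by (simp add: Collect_ball_eq closed_INT closed_Collect_eq continuous_on_inner)
  have invariant: "S *v x \<in> V" if "x \<in> V" for x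
  proof -
    have "b \<bullet> (S *v x) = (b \<bullet> (S *v b)) * (b \<bullet> x)" if "b \<in> B" for b
      using symmetric_mat_inner_commute[OF assms(1), of b x] eigen that by (metis inner_scaleR_left)
    with \<open>x \<in> V\<close> show ?thesis
      by (simp add: V_def)
  qed
  obtain v where "v \<in> V" and "norm v = 1"
    and "\<And>y. y \<in> V \<Longrightarrow> y \<bullet> (S *v y) \<le> (v \<bullet> (S *v v)) * (y \<bullet> y)"
    using exists_rayleigh_maximizer[OF \<open>subspace V\<close> \<open>closed V\<close>, of a S] assms(3,4)
    by (auto simp: V_def)
  with rayleigh_maximizer_eigenvector[OF assms(1) \<open>subspace V\<close> invariant] that show ?thesis
    by (simp add: V_def)
qed

definition orthonormal_set :: "(real^'n) set \<Rightarrow> bool" where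
  "orthonormal_set B \<longleftrightarrow> (\<forall>b\<in>B. \<forall>c\<in>B. b \<bullet> c = (if b = c then 1 else 0))"

lemma orthonormal_set_coefficient:
  assumes "orthonormal_set B" and "finite B" and "c \<in> B"
  shows "c \<bullet> (\<Sum>b\<in>B. f b *\<^sub>R b) = f c"
proof -
  have "c \<bullet> (\<Sum>b\<in>B. f b *\<^sub>R b) = (\<Sum>b\<in>B. if b = c then f b else 0)"
    using assms(1,3) by (simp add: inner_sum_right) (intro sum.cong, auto simp: orthonormal_set_def)
  then show ?thesis
    using assms(2,3) by simp
qed

lemma orthonormal_set_independent:
  assumes "orthonormal_set B"
  shows "independent B"
proof -
  have "pairwise orthogonal B"
    using assms by (auto simp: pairwise_def orthogonal_def orthonormal_set_def)
  moreover have "0 \<notin> B"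
    using assms by (force simp: orthonormal_set_def)
  ultimately show ?thesis
    using pairwise_orthogonal_independent by blast
qed

lemma symmetric_mat_orthonormal_eigenvectors:
  fixes S :: "real^'n^'n"
  assumes "symmetric_mat S" and "k \<le> CARD('n)"
  shows "\<exists>B. finite B \<and> card B = k \<and> orthonormal_set B \<and> (\<forall>b\<in>B. S *v b = (b \<bullet> (S *v b)) *\<^sub>R b)"
  using assms(2)
proof (induction k)
  case 0
  show ?case
    by (intro exI[of _ "{}"]) (auto simp: orthonormal_set_def)
next
  case (Suc k)
  then obtain B where "finite B" "card B = k" "orthonormal_set B"
    and eigen: "\<forall>b\<in>B. S *v b = (b \<bullet> (S *v b)) *\<^sub>R b"
    by auto
  have "dim (span B) = k"
    using dim_span_eq_card_independent orthonormal_set_independent \<open>orthonormal_set B\<close> \<open>card B = k\<close>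
    by metis
  moreover have "dim (UNIV :: (real^'n) set) = CARD('n)"
    by simp
  ultimately have "span B \<noteq> UNIV"
    using Suc.prems by (metis Suc_n_not_le_n)
  then obtain a where "a \<noteq> 0" and "\<forall>x\<in>span B. a \<bullet> x = 0"
    using span_not_UNIV_orthogonal by blast
  then have "\<forall>b\<in>B. b \<bullet> a = 0"
    by (simp add: inner_commute span_base)
  then obtain v where v: "norm v = 1" "\<forall>b\<in>B. b \<bullet> v = 0" "S *v v = (v \<bullet> (S *v v)) *\<^sub>R v"
    using symmetric_mat_eigenvector_orthogonal[OF assms(1) eigen \<open>a \<noteq> 0\<close>] by blast
  then have "v \<bullet> v = 1" and "v \<notin> B"
    by (auto simp: dot_square_norm)
  show ?case
  proof (intro exI[of _ "insert v B"] conjI)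
    show "orthonormal_set (insert v B)"
      using \<open>orthonormal_set B\<close> v(2) \<open>v \<bullet> v = 1\<close> by (auto simp: orthonormal_set_def inner_commute)
  qed (use \<open>finite B\<close> \<open>v \<notin> B\<close> \<open>card B = k\<close> eigen v(3) in auto)
qed

lemma symmetric_mat_eigenbasis:
  fixes S :: "real^'n^'n"
  assumes "symmetric_mat S"
  obtains B where "finite B" and "orthonormal_set B" and "\<forall>b\<in>B. S *v b = (b \<bullet> (S *v b)) *\<^sub>R b"
    and "\<And>x. x = (\<Sum>b\<in>B. (b \<bullet> x) *\<^sub>R b)"
proof -
  obtain B where "finite B" "card B = CARD('n)" "orthonormal_set B"
    and eigen: "\<forall>b\<in>B. S *v b = (b \<bullet> (S *v b)) *\<^sub>R b"
    using symmetric_mat_orthonormal_eigenvectors[OF assms order_refl] by auto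
  then have "UNIV \<subseteq> span B"
    using card_eq_dim[of B UNIV] orthonormal_set_independent[of B] by simp
  have "x = (\<Sum>b\<in>B. (b \<bullet> x) *\<^sub>R b)" for x
  proof -
    define y where "y = x - (\<Sum>b\<in>B. (b \<bullet> x) *\<^sub>R b)"
    have "orthogonal y c" if "c \<in> B" for c
    proof -
      have "c \<bullet> y = 0"
        using orthonormal_set_coefficient[OF \<open>orthonormal_set B\<close> \<open>finite B\<close> that, of "\<lambda>b. b \<bullet> x"]
        unfolding y_def inner_diff_right by simp
      then show ?thesis
        by (simp add: orthogonal_def inner_commute)
    qed
    then have "orthogonal y y"
      using orthogonal_to_span[of y B y] \<open>UNIV \<subseteq> span B\<close> by blast
    then show ?thesis
      by (simp add: y_def orthogonal_self)
  qed
  then show ?thesis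
    using that \<open>finite B\<close> \<open>orthonormal_set B\<close> eigen by blast
qed

lemma orthonormal_set_spectral_matrix:
  fixes B :: "(real^'n) set" and c :: "real^'n \<Rightarrow> real"
  assumes "orthonormal_set B" and "finite B"
  obtains R where "symmetric_mat R" and "\<And>x. R *v x = (\<Sum>b\<in>B. (c b * (b \<bullet> x)) *\<^sub>R b)"
proof -
  define f where "f x = (\<Sum>b\<in>B. (c b * (b \<bullet> x)) *\<^sub>R b)" for x
  have "linear f"
    by (rule linearI) (simp_all add: f_def inner_add_right distrib_left scaleR_add_left
        sum.distrib scaleR_sum_right mult.left_commute)
  define R where "R = matrix f"
  have R: "R *v x = f x" for x
    using matrix_works[OF \<open>linear f\<close>[folded linear_matrix_vector_mul_eq]] by (simp add: R_def)
  have "symmetric_mat R"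
  proof (rule symmetric_matI)
    fix x y :: "real^'n"
    have "(R *v x) \<bullet> y = (\<Sum>b\<in>B. c b * (b \<bullet> x) * (b \<bullet> y))" for x y
      by (simp add: R f_def inner_sum_left)
    then show "(R *v x) \<bullet> y = x \<bullet> (R *v y)"
      by (simp add: inner_commute[of x] mult_ac)
  qed
  then show ?thesis
    using that R unfolding f_def by blast
qed

lemma pos_def_spectral_matrix:
  fixes R :: "real^'n^'n" and B :: "(real^'n) set"
  assumes "finite B" and expansion: "\<And>x. x = (\<Sum>b\<in>B. (b \<bullet> x) *\<^sub>R b)"
    and "\<And>b. b \<in> B \<Longrightarrow> c b > 0" and R: "\<And>x. R *v x = (\<Sum>b\<in>B. (c b * (b \<bullet> x)) *\<^sub>R b)"
  shows "pos_def R"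
  unfolding pos_def_def
proof (intro allI impI)
  fix x :: "real^'n"
  assume "x \<noteq> 0"
  then obtain b0 where "b0 \<in> B" and "b0 \<bullet> x \<noteq> 0"
    using expansion[of x] by (metis (no_types, lifting) scale_eq_0_iff sum.neutral)
  have "x \<bullet> (R *v x) = (\<Sum>b\<in>B. c b * (b \<bullet> x)\<^sup>2)"
    by (simp add: R inner_sum_right inner_commute[of x] power2_eq_square mult_ac)
  also have "\<dots> > 0"
  proof (rule sum_pos2[OF \<open>finite B\<close> \<open>b0 \<in> B\<close>])
    show "0 < c b0 * (b0 \<bullet> x)\<^sup>2"
      using assms(3)[OF \<open>b0 \<in> B\<close>] \<open>b0 \<bullet> x \<noteq> 0\<close> by simp
  qed (use assms(3) in \<open>simp add: less_imp_le\<close>)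
  finally show "x \<bullet> (R *v x) > 0" .
qed

lemma pos_def_sqrt:
  fixes S :: "real^'n^'n"
  assumes "symmetric_mat S" and "pos_def S"
  obtains R where "symmetric_mat R" and "pos_def R" and "R ** R = S"
proof -
  obtain B where "finite B" and "orthonormal_set B"
    and eigen: "\<forall>b\<in>B. S *v b = (b \<bullet> (S *v b)) *\<^sub>R b"
    and expansion: "\<And>x. x = (\<Sum>b\<in>B. (b \<bullet> x) *\<^sub>R b)"
    using symmetric_mat_eigenbasis[OF assms(1)] by blast
  define eigval where "eigval b = b \<bullet> (S *v b)" for b
  have eigval_pos: "eigval b > 0" if "b \<in> B" for b
  proof -
    have "b \<noteq> 0"
      using \<open>orthonormal_set B\<close> that by (force simp: orthonormal_set_def)
    then show ?thesis
      using assms(2) by (simp add: pos_def_def eigval_def)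
  qed
  obtain R where "symmetric_mat R" and R: "\<And>x. R *v x = (\<Sum>b\<in>B. (sqrt (eigval b) * (b \<bullet> x)) *\<^sub>R b)"
    using orthonormal_set_spectral_matrix[OF \<open>orthonormal_set B\<close> \<open>finite B\<close>, of "\<lambda>b. sqrt (eigval b)"]
    by blast
  have R_coefficient: "b \<bullet> (R *v x) = sqrt (eigval b) * (b \<bullet> x)" if "b \<in> B" for b x
    unfolding R using orthonormal_set_coefficient[OF \<open>orthonormal_set B\<close> \<open>finite B\<close> that] .
  have "pos_def R"
    by (rule pos_def_spectral_matrix[OF \<open>finite B\<close> expansion _ R]) (simp add: eigval_pos)
  have "(R ** R) *v x = S *v x" for x
  proof -
    have "(R ** R) *v x = (\<Sum>b\<in>B. (eigval b * (b \<bullet> x)) *\<^sub>R b)"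
      unfolding matrix_vector_mul_assoc[symmetric] R[of "R *v x"]
      by (intro sum.cong refl) (simp add: R_coefficient eigval_pos less_imp_le mult.assoc[symmetric])
    also have "\<dots> = (\<Sum>b\<in>B. (b \<bullet> x) *\<^sub>R (S *v b))"
    proof (intro sum.cong refl)
      fix b
      assume "b \<in> B"
      then have "S *v b = eigval b *\<^sub>R b"
        using eigen by (simp add: eigval_def)
      then show "(eigval b * (b \<bullet> x)) *\<^sub>R b = (b \<bullet> x) *\<^sub>R (S *v b)"
        by (simp add: mult.commute)
    qed
    also have "\<dots> = S *v x"
      by (subst (2) expansion[of x]) (simp add: vec.sum matrix_vector_mult_scaleR)
    finally show ?thesis .
  qed
  then have "R ** R = S"
    by (simp add: matrix_eq)
  with \<open>symmetric_mat R\<close> \<open>pos_def R\<close> show ?thesis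
    using that by blast
qed

section \<open>Linear change of variables\<close>

lemma det_matrix_stretch:
  "det (matrix (\<lambda>x::real^'n. \<chi> i. c i * x $ i)) = prod c UNIV"
  by (simp add: matrix_def axis_def det_diagonal)

lemma abs_det_matrix_swap:
  "\<bar>det (matrix (\<lambda>x::real^'n. \<chi> i. x $ Transposition.transpose m n i))\<bar> = 1"
proof -
  have "matrix (\<lambda>x::real^'n. \<chi> i. x $ Transposition.transpose m n i)
      = transpose (\<chi> i j. mat 1 $ i $ Transposition.transpose m n j)"
    by (simp add: matrix_def transpose_def mat_def axis_def vec_eq_iff eq_commute)
  then show ?thesis
    by (simp add: det_permute_columns permutes_swap_id sign_swap_id abs_mult)
qed

lemma det_matrix_shear:
  assumes "m \<noteq> n"
  shows "det (matrix (\<lambda>x::real^'n. \<chi> i. if i = m then x $ m + x $ n else x $ i)) = 1"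
proof -
  have "matrix (\<lambda>x::real^'n. \<chi> i. if i = m then x $ m + x $ n else x $ i)
      = (\<chi> k. if k = m then row m (mat 1) + 1 *s row n (mat 1) else row k (mat 1))"
    by (auto simp: matrix_def row_def mat_def axis_def vec_eq_iff)
  then show ?thesis
    using det_row_operation[OF assms, of "mat 1" 1] by simp
qed

lemma measure_swap_coordinates_image:
  fixes S :: "(real^'n) set" and m n :: 'n
  assumes "S \<in> lmeasurable"
  defines "s \<equiv> \<lambda>x::real^'n. \<chi> i. x $ Transposition.transpose m n i"
  shows "s ` S \<in> lmeasurable" and "measure lebesgue (s ` S) = measure lebesgue S"
proof -
  have "linear s"
    unfolding s_def by (rule linearI) (simp_all add: plus_vec_def scaleR_vec_def)
  have "measure lebesgue (s ` cbox a b) = measure lebesgue (cbox a b)" for a b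
  proof (cases "cbox a b = {}")
    case False
    have image: "s ` cbox a b = cbox (s a) (s b)"
      unfolding s_def
      by (auto simp: image_iff lambda_swap_Galois mem_box_cart) (metis transpose_involutory)+
    then have "cbox (s a) (s b) \<noteq> {}"
      using False by auto
    moreover have "(\<Prod>i\<in>UNIV. s b $ i - s a $ i) = (\<Prod>i\<in>UNIV. b $ i - a $ i)"
      using prod.permute[OF permutes_swap_id, where S=UNIV and g="\<lambda>i. b $ i - a $ i"]
      by (simp add: s_def comp_def)
    ultimately show ?thesis
      using False by (simp add: image content_cbox_cart)
  qed simp
  then show "s ` S \<in> lmeasurable" "measure lebesgue (s ` S) = measure lebesgue S"
    using measure_linear_sufficient[OF \<open>linear s\<close> assms(1), of 1] by simp_all
qed

lemma measure_shear_image: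
  fixes S :: "(real^'n) set" and m n :: 'n
  assumes "m \<noteq> n" and "S \<in> lmeasurable"
  defines "h \<equiv> \<lambda>x::real^'n. \<chi> i. if i = m then x $ m + x $ n else x $ i"
  shows "h ` S \<in> lmeasurable" and "measure lebesgue (h ` S) = measure lebesgue S"
proof -
  have "linear h"
    unfolding h_def by (rule linearI) (simp_all add: vec_eq_iff algebra_simps)
  have "measure lebesgue (h ` cbox a b) = measure lebesgue (cbox a b)" for a b
  proof (cases "cbox a b = {}")
    case False
    \<comment> \<open>\<open>measure_shear_interval\<close> needs \<open>0 \<le> a $ n\<close>; translate the box to the origin first.\<close>
    have ne: "cbox 0 (b - a) \<noteq> {}"
      using False by (auto simp: interval_ne_empty_cart)
    have box: "cbox a b = (+) a ` cbox 0 (b - a)"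
      using cbox_translation[of a 0 "b - a"] by simp
    have "h ` cbox a b = (+) (h a) ` h ` cbox 0 (b - a)"
      unfolding box image_image h_def by (intro image_cong refl) (simp add: vec_eq_iff)
    then have "measure lebesgue (h ` cbox a b) = measure lebesgue (h ` cbox 0 (b - a))"
      by (simp add: measure_translation)
    also have "\<dots> = measure lebesgue (cbox 0 (b - a))"
      unfolding h_def using measure_shear_interval[OF assms(1) ne] by simp
    also have "\<dots> = measure lebesgue (cbox a b)"
      by (simp add: box measure_translation)
    finally show ?thesis .
  qed simp
  then show "h ` S \<in> lmeasurable" "measure lebesgue (h ` S) = measure lebesgue S"
    using measure_linear_sufficient[OF \<open>linear h\<close> assms(2), of 1] by simp_all
qed

text \<open>The library's \<open>measure_linear_image\<close> is stated for well-ordered index types only; the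
  same reduction to elementary maps works over any finite index type once the map is invertible.\<close>

lemma measure_linear_image_nonsingular:
  fixes f :: "real^'n \<Rightarrow> real^'n"
  assumes "linear f" and "det (matrix f) \<noteq> 0" and "S \<in> lmeasurable"
  shows "f ` S \<in> lmeasurable"
    and "measure lebesgue (f ` S) = \<bar>det (matrix f)\<bar> * measure lebesgue S"
proof -
  let ?P = "\<lambda>f. det (matrix f) \<noteq> 0 \<longrightarrow> (\<forall>S \<in> lmeasurable.
    f ` S \<in> lmeasurable \<and> measure lebesgue (f ` S) = \<bar>det (matrix f)\<bar> * measure lebesgue S)"
  have "?P f"
  proof (rule induct_linear_elementary[OF \<open>linear f\<close>])
    fix f g :: "real^'n \<Rightarrow> real^'n"
    assume "linear f" "linear g" and f: "?P f" and g: "?P g"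
    have det: "det (matrix (f \<circ> g)) = det (matrix f) * det (matrix g)"
      by (simp add: matrix_compose[OF \<open>linear g\<close> \<open>linear f\<close>] det_mul)
    show "?P (f \<circ> g)"
    proof (intro impI ballI)
      fix S :: "(real^'n) set"
      assume "det (matrix (f \<circ> g)) \<noteq> 0" and "S \<in> lmeasurable"
      with f g have "g ` S \<in> lmeasurable" "f ` g ` S \<in> lmeasurable"
        "measure lebesgue (f ` g ` S) = \<bar>det (matrix f)\<bar> * (\<bar>det (matrix g)\<bar> * measure lebesgue S)"
        by (auto simp: det)
      then show "(f \<circ> g) ` S \<in> lmeasurable \<and>
          measure lebesgue ((f \<circ> g) ` S) = \<bar>det (matrix (f \<circ> g))\<bar> * measure lebesgue S"
        unfolding image_comp[symmetric] det abs_mult mult.assoc by blast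
    qed
  next
    fix f :: "real^'n \<Rightarrow> real^'n" and i
    assume "linear f" and "\<And>x. f x $ i = 0"
    then have "row i (matrix f) = 0"
      by (simp add: row_def matrix_def vec_eq_iff)
    then show "?P f"
      by (simp add: det_zero_row)
  next
    fix c :: "'n \<Rightarrow> real"
    show "?P (\<lambda>x. \<chi> i. c i * x $ i)"
      unfolding det_matrix_stretch using measurable_stretch measure_stretch by blast
  next
    fix m n :: 'n
    show "?P (\<lambda>x. \<chi> i. x $ Transposition.transpose m n i)"
      using measure_swap_coordinates_image[of _ m n] unfolding abs_det_matrix_swap mult_1
      by blast
  next
    fix m n :: 'n
    assume "m \<noteq> n"
    show "?P (\<lambda>x. \<chi> i. if i = m then x $ m + x $ n else x $ i)"
      using measure_shear_image[OF \<open>m \<noteq> n\<close>] unfolding det_matrix_shear[OF \<open>m \<noteq> n\<close>] abs_1 mult_1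
      by blast
  qed
  with assms show "f ` S \<in> lmeasurable"
    and "measure lebesgue (f ` S) = \<bar>det (matrix f)\<bar> * measure lebesgue S"
    by blast+
qed

lemma borel_measurable_matrix_vector_mult [measurable]:
  "(*v) (A :: real^'n^'m) \<in> borel_measurable borel"
  by (intro borel_measurable_continuous_onI continuous_intros)

lemma lborel_eq_density_distr_matrix:
  fixes L :: "real^'n^'n"
  assumes "invertible L"
  shows "lborel = density (distr lborel borel ((*v) L)) (\<lambda>_. ennreal \<bar>det L\<bar>)"
proof (rule lborel_eqI)
  let ?Li = "matrix_inv L"
  have preimage: "(*v) L -` X = (*v) ?Li ` X" for X
    using matrix_inv_left[OF assms] matrix_inv_right[OF assms]
    by (auto simp: image_iff matrix_vector_mul_assoc intro!: bexI[of _ "L *v _"])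
  have det: "\<bar>det L\<bar> * \<bar>det ?Li\<bar> = 1"
    using arg_cong[OF matrix_inv_right[OF assms], of det] by (simp add: det_mul abs_mult[symmetric])
  then have "det (matrix ((*v) ?Li)) \<noteq> 0"
    by auto
  note image = measure_linear_image_nonsingular[OF matrix_vector_mul_linear this]
  fix l u :: "real^'n"
  assume "\<And>b. b \<in> Basis \<Longrightarrow> l \<bullet> b \<le> u \<bullet> b"
  have "(*v) ?Li ` box l u \<in> sets lborel"
    using measurable_sets_borel[of "(*v) L" borel "box l u"] by (simp add: preimage)
  then have "emeasure lborel ((*v) L -` box l u) = emeasure lebesgue ((*v) ?Li ` box l u)"
    by (simp add: preimage)
  also have "\<dots> = ennreal (\<bar>det ?Li\<bar> * measure lebesgue (box l u))"
    using image[of "box l u"] by (simp add: emeasure_eq_measure2)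
  finally have "emeasure lborel ((*v) L -` box l u)
      = ennreal (\<bar>det ?Li\<bar> * measure lebesgue (box l u))" .
  then have "emeasure (density (distr lborel borel ((*v) L)) (\<lambda>_. ennreal \<bar>det L\<bar>)) (box l u)
      = ennreal (measure lebesgue (box l u))"
    using det by (simp add: emeasure_density emeasure_distr nn_integral_cmult_indicator
        ennreal_mult'[symmetric] mult.assoc[symmetric])
  also have "\<dots> = (\<Prod>b\<in>Basis. (u - l) \<bullet> b)"
    using \<open>\<And>b. b \<in> Basis \<Longrightarrow> l \<bullet> b \<le> u \<bullet> b\<close>
    by (simp add: emeasure_eq_measure2[symmetric] emeasure_lborel_box_eq)
  finally show "emeasure (density (distr lborel borel ((*v) L)) (\<lambda>_. ennreal \<bar>det L\<bar>)) (box l u)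
      = (\<Prod>b\<in>Basis. (u - l) \<bullet> b)" .
qed simp

lemma nn_integral_lborel_matrix:
  fixes L :: "real^'n^'n"
  assumes "invertible L" and [measurable]: "h \<in> borel_measurable borel"
  shows "(\<integral>\<^sup>+x. h x \<partial>lborel) = (\<integral>\<^sup>+u. ennreal \<bar>det L\<bar> * h (L *v u) \<partial>lborel)"
proof -
  have "(\<integral>\<^sup>+x. h x \<partial>lborel)
      = (\<integral>\<^sup>+x. h x \<partial>density (distr lborel borel ((*v) L)) (\<lambda>_. ennreal \<bar>det L\<bar>))"
    by (subst lborel_eq_density_distr_matrix[OF assms(1)]) (rule refl)
  also have "\<dots> = (\<integral>\<^sup>+u. ennreal \<bar>det L\<bar> * h (L *v u) \<partial>lborel)"
    by (simp add: nn_integral_density nn_integral_distr)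
  finally show ?thesis .
qed

section \<open>The standard Gaussian measure\<close>

lemma borel_measurable_gaussian_density [measurable]:
  "gaussian_density S \<in> borel_measurable borel"
  unfolding gaussian_density_def
  by (intro borel_measurable_divide borel_measurable_const borel_measurable_continuous_onI
      continuous_intros) simp

lemma gaussian_density_mat_1:
  "gaussian_density (mat 1) (u::real^'m) = exp (- (u \<bullet> u) / 2) / sqrt ((2 * pi) ^ CARD('m))"
  by (simp add: gaussian_density_def matrix_inv_mat_1)

lemma gaussian_density_mat_1_eq_prod:
  "gaussian_density (mat 1) (u::real^'m) = (\<Prod>b\<in>Basis. std_normal_density (u \<bullet> b))"
proof -
  have "(\<Prod>b\<in>(Basis::(real^'m) set). std_normal_density (u \<bullet> b))
      = (\<Prod>b\<in>(Basis::(real^'m) set). 1 / sqrt (2 * pi))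
        * (\<Prod>b\<in>(Basis::(real^'m) set). exp (- (u \<bullet> b)\<^sup>2 / 2))"
    unfolding std_normal_density_def by (rule prod.distrib)
  also have "\<dots> = (1 / sqrt (2 * pi)) ^ CARD('m) * exp (\<Sum>b\<in>(Basis::(real^'m) set). - (u \<bullet> b)\<^sup>2 / 2)"
    by (simp add: exp_sum)
  also have "(\<Sum>b\<in>(Basis::(real^'m) set). - (u \<bullet> b)\<^sup>2 / 2) = - (u \<bullet> u) / 2"
    by (simp add: euclidean_inner[of u u] power2_eq_square sum_negf sum_divide_distrib[symmetric])
  also have "(1 / sqrt (2 * pi)) ^ CARD('m) = 1 / sqrt ((2 * pi) ^ CARD('m))"
    by (simp only: real_sqrt_power power_one_over)
  finally show ?thesis
    by (simp add: gaussian_density_mat_1)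
qed

lemma prob_space_gaussian_measure_mat_1:
  "prob_space (gaussian_measure (mat 1 :: real^'m^'m))"
proof
  interpret product_sigma_finite "\<lambda>_::real^'m. lborel :: real measure"
    by standard
  have std: "(\<integral>\<^sup>+x. ennreal (std_normal_density x) \<partial>lborel) = 1"
  proof -
    interpret prob_space "density lborel std_normal_density"
      using prob_space_normal_density[of 1 0] by simp
    show ?thesis
      using emeasure_space_1 by (simp add: emeasure_density)
  qed
  have coordinate: "(\<Sum>b\<in>Basis. f b *\<^sub>R b :: real^'m) \<bullet> c = f c" if "c \<in> Basis" for f c
    using that by (simp add: inner_sum_left inner_Basis if_distrib cong: if_cong)
  have "emeasure (gaussian_measure (mat 1 :: real^'m^'m)) UNIV
      = (\<integral>\<^sup>+u. ennreal (gaussian_density (mat 1) (u::real^'m)) \<partial>lborel)"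
    by (simp add: gaussian_measure_def emeasure_density)
  also have "\<dots> = (\<integral>\<^sup>+u. ennreal (gaussian_density (mat 1) (u::real^'m))
      \<partial>distr (\<Pi>\<^sub>M b\<in>Basis. lborel) borel (\<lambda>f. \<Sum>b\<in>Basis. f b *\<^sub>R b))"
    by (subst lborel_eq) (rule refl)
  also have "\<dots> = (\<integral>\<^sup>+f. (\<Prod>b\<in>(Basis::(real^'m) set). ennreal (std_normal_density (f b)))
      \<partial>(\<Pi>\<^sub>M b\<in>Basis. lborel))"
    by (simp add: nn_integral_distr gaussian_density_mat_1_eq_prod coordinate prod_ennreal)
  also have "\<dots> = (\<Prod>b\<in>(Basis::(real^'m) set). \<integral>\<^sup>+x. ennreal (std_normal_density x) \<partial>lborel)"
    by (rule product_nn_integral_prod) auto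
  also have "\<dots> = 1"
    by (simp add: std)
  finally show "emeasure (gaussian_measure (mat 1 :: real^'m^'m))
      (space (gaussian_measure (mat 1))) = 1"
    by (simp add: gaussian_measure_def)
qed

lemma gaussian_measure_linear_image:
  fixes L :: "real^'m^'m"
  assumes "invertible L"
  shows "gaussian_measure (L ** transpose L) = distr (gaussian_measure (mat 1)) borel ((*v) L)"
proof (rule measure_eqI)
  let ?Li = "matrix_inv L"
  have "matrix_inv (L ** transpose L) = transpose ?Li ** ?Li"
    using assms by (simp add: matrix_inv_mult transpose_invertible transpose_matrix_inv)
  then have quadratic: "(L *v u) \<bullet> (matrix_inv (L ** transpose L) *v (L *v u)) = u \<bullet> u" for u
    by (simp only: matrix_vector_mul_assoc[symmetric] inner_transpose_matrix_vector)
      (simp add: matrix_vector_mul_assoc matrix_inv_left assms)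
  have "det (L ** transpose L) = \<bar>det L\<bar>\<^sup>2"
    by (simp add: det_mul power2_eq_square)
  then have "sqrt ((2 * pi) ^ CARD('m) * det (L ** transpose L))
      = sqrt ((2 * pi) ^ CARD('m)) * \<bar>det L\<bar>"
    by (simp add: real_sqrt_mult)
  moreover have "det L \<noteq> 0"
    using assms by (simp add: invertible_det_nz)
  ultimately have density:
    "\<bar>det L\<bar> * gaussian_density (L ** transpose L) (L *v u) = gaussian_density (mat 1) u" for u
    by (simp add: gaussian_density_def matrix_inv_mat_1 quadratic)
  fix X
  assume "X \<in> sets (gaussian_measure (L ** transpose L))"
  then have [measurable]: "X \<in> sets borel"
    by (simp add: gaussian_measure_def)
  have "emeasure (gaussian_measure (L ** transpose L)) X
      = (\<integral>\<^sup>+z. ennreal (gaussian_density (L ** transpose L) z) * indicator X z \<partial>lborel)"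
    by (simp add: gaussian_measure_def emeasure_density)
  also have "\<dots> = (\<integral>\<^sup>+u. ennreal \<bar>det L\<bar> *
      (ennreal (gaussian_density (L ** transpose L) (L *v u)) * indicator X (L *v u)) \<partial>lborel)"
    by (rule nn_integral_lborel_matrix[OF assms]) measurable
  also have "\<dots> = (\<integral>\<^sup>+u. ennreal (gaussian_density (mat 1) u) * indicator X (L *v u) \<partial>lborel)"
    by (simp add: mult.assoc[symmetric] ennreal_mult'[symmetric] density)
  also have "\<dots> = emeasure (gaussian_measure (mat 1)) ((*v) L -` X)"
    using measurable_sets_borel[of "(*v) L" borel X]
    by (simp add: gaussian_measure_def emeasure_density indicator_vimage)
  also have "\<dots> = emeasure (distr (gaussian_measure (mat 1)) borel ((*v) L)) X"
    by (simp add: gaussian_measure_def emeasure_distr)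
  finally show "emeasure (gaussian_measure (L ** transpose L)) X
      = emeasure (distr (gaussian_measure (mat 1)) borel ((*v) L)) X" .
qed (simp add: gaussian_measure_def)

lemma emeasure_gaussian_measure_mat_1_open_pos:
  fixes U :: "(real^'m) set"
  assumes "open U" and "U \<noteq> {}"
  shows "emeasure (gaussian_measure (mat 1)) U > 0"
proof (rule ccontr)
  have [measurable]: "U \<in> sets borel"
    using assms(1) by simp
  assume "\<not> emeasure (gaussian_measure (mat 1)) U > 0"
  then have "(\<integral>\<^sup>+x. ennreal (gaussian_density (mat 1) x) * indicator U x \<partial>lborel) = 0"
    by (simp add: gaussian_measure_def emeasure_density)
  then have "AE x in lborel. ennreal (gaussian_density (mat 1) x) * indicator U x = 0"
    by (simp add: nn_integral_0_iff_AE)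
  then have "AE x in lborel. x \<notin> U"
    by (simp add: gaussian_density_mat_1 indicator_def)
  then have "emeasure lebesgue U = 0"
    by (simp add: AE_iff_measurable[OF _ refl])
  then show False
    using open_not_negligible[OF assms] by (simp add: negligible_iff_emeasure0 assms(1))
qed

lemma succ_mat_quadratic_less:
  assumes "succ_mat X Y" and "u \<noteq> 0"
  shows "u \<bullet> (Y *v u) < u \<bullet> (X *v u)"
  using assms by (simp add: succ_mat_def pos_def_def matrix_vector_mult_diff_rdistrib inner_diff_right)

lemma quadratic_forms_separated_by_level:
  fixes X Y :: "real^'m^'m"
  assumes "\<tau> > 0" and "pos_def Y" and "succ_mat X Y"
  obtains u where "u \<bullet> (Y *v u) < \<tau>" and "\<tau> < u \<bullet> (X *v u)"
proof -
  define e :: "real^'m" where "e = 1"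
  have "e \<noteq> 0"
    by (simp add: e_def vec_eq_iff)
  define qx where "qx = e \<bullet> (X *v e)"
  define qy where "qy = e \<bullet> (Y *v e)"
  have "0 < qy" and "qy < qx"
    using assms(2,3) \<open>e \<noteq> 0\<close> succ_mat_quadratic_less
    by (simp_all add: qx_def qy_def pos_def_def)
  \<comment> \<open>\<open>s\<close> is chosen so that \<open>\<tau>\<close> is the midpoint of \<open>s\<^sup>2 * qy\<close> and \<open>s\<^sup>2 * qx\<close>.\<close>
  define s where "s = sqrt (2 * \<tau> / (qx + qy))"
  have s2: "s\<^sup>2 = 2 * \<tau> / (qx + qy)"
    using assms(1) \<open>0 < qy\<close> \<open>qy < qx\<close> by (simp add: s_def)
  have "s\<^sup>2 * qy < \<tau>" and "\<tau> < s\<^sup>2 * qx"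
    unfolding s2 using assms(1) \<open>0 < qy\<close> \<open>qy < qx\<close> by (simp_all add: field_simps)
  then show ?thesis
    using that[of "s *\<^sub>R e"] by (simp add: qx_def qy_def matrix_vector_mult_scaleR power2_eq_square)
qed

lemma measure_gaussian_quadratic_tail_less:
  fixes Ta Tb :: "real^'m^'m"
  assumes "\<tau> > 0" and "pos_def Tb" and "succ_mat Ta Tb"
  shows "measure (gaussian_measure (mat 1)) {u. \<tau> < u \<bullet> (Tb *v u)}
       < measure (gaussian_measure (mat 1)) {u. \<tau> < u \<bullet> (Ta *v u)}"
proof -
  interpret N: prob_space "gaussian_measure (mat 1 :: real^'m^'m)"
    by (rule prob_space_gaussian_measure_mat_1)
  define A where "A = {u::real^'m. \<tau> < u \<bullet> (Tb *v u)}"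
  define B where "B = {u::real^'m. \<tau> < u \<bullet> (Ta *v u)}"
  define U where "U = {u::real^'m. u \<bullet> (Tb *v u) < \<tau>} \<inter> {u. \<tau> < u \<bullet> (Ta *v u)}"
  have "A \<subseteq> B"
  proof
    fix u
    assume "u \<in> A"
    then have "u \<noteq> 0"
      using assms(1) by (auto simp: A_def)
    with \<open>u \<in> A\<close> show "u \<in> B"
      using succ_mat_quadratic_less[OF assms(3), of u] by (simp add: A_def B_def)
  qed
  have "U \<subseteq> B - A"
    by (auto simp: U_def A_def B_def)
  have "open U"
    unfolding U_def by (intro open_Int open_Collect_less continuous_intros)
  moreover have "U \<noteq> {}"
    using quadratic_forms_separated_by_level[OF assms] unfolding U_def by blast
  ultimately have "0 < N.prob U"
    using emeasure_gaussian_measure_mat_1_open_pos[of U] by (simp add: N.emeasure_eq_measure)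
  have [measurable]: "A \<in> sets borel" "B \<in> sets borel"
    unfolding A_def B_def by (intro borel_open open_Collect_less continuous_intros)+
  have "N.prob U \<le> N.prob (B - A)"
    using \<open>U \<subseteq> B - A\<close> by (intro N.finite_measure_mono) (simp_all add: gaussian_measure_def)
  also have "\<dots> = N.prob B - N.prob A"
    using \<open>A \<subseteq> B\<close> by (intro N.finite_measure_Diff) (simp_all add: gaussian_measure_def)
  finally show ?thesis
    using \<open>0 < N.prob U\<close> by (simp add: A_def B_def)
qed

section \<open>Block covariances and the false-alarm probability\<close>

definition block_restrict :: "('n \<Rightarrow> 'k) \<Rightarrow> 'k \<Rightarrow> real^'n \<Rightarrow> real^'n" where
  "block_restrict blk j x = (\<chi> p. if blk p = j then x $ p else 0)"

lemma sum_block_restrict: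
  fixes blk :: "'n::finite \<Rightarrow> 'k"
  shows "(\<Sum>j\<in>range blk. block_restrict blk j x) = x"
proof -
  have "(\<Sum>j\<in>range blk. block_restrict blk j x) $ p = x $ p" for p
  proof -
    have "(\<Sum>j\<in>range blk. block_restrict blk j x) $ p = (\<Sum>j\<in>range blk. if blk p = j then x $ p else 0)"
      by (simp add: block_restrict_def)
    also have "\<dots> = x $ p"
      by (simp add: sum.delta[OF finite_imageI[OF finite_class.finite_UNIV]])
    finally show ?thesis .
  qed
  then show ?thesis
    by (simp add: vec_eq_iff)
qed

lemma quadratic_form_block_diag:
  fixes D :: "real^'n^'n" and blk :: "'n \<Rightarrow> 'k"
  assumes "block_diag blk D"
  shows "x \<bullet> (D *v x) = (\<Sum>j\<in>range blk. block_restrict blk j x \<bullet> (D *v block_restrict blk j x))"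
proof -
  let ?x = "\<lambda>j. block_restrict blk j x"
  have cross: "?x j \<bullet> (D *v ?x k) = 0" if "j \<noteq> k" for j k
  proof -
    have "?x j $ p * (D *v ?x k) $ p = 0" for p
    proof (cases "blk p = j")
      case True
      have "D $ p $ q * ?x k $ q = 0" for q
        using assms True that by (cases "blk q = k") (auto simp: block_restrict_def block_diag_def)
      then have "(D *v ?x k) $ p = 0"
        unfolding matrix_vector_mult_def by (simp only: vec_lambda_beta sum.neutral_const)
      then show ?thesis
        by simp
    qed (simp add: block_restrict_def)
    then show ?thesis
      unfolding inner_vec_def inner_real_def by (simp only: sum.neutral_const)
  qed
  have "x \<bullet> (D *v x) = (\<Sum>k\<in>range blk. \<Sum>j\<in>range blk. ?x j \<bullet> (D *v ?x k))"
    by (subst (1 2) sum_block_restrict[of blk x, symmetric])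
      (simp add: vec.sum inner_sum_left inner_sum_right)
  also have "\<dots> = (\<Sum>j\<in>range blk. \<Sum>k\<in>range blk. ?x j \<bullet> (D *v ?x k))"
    by (rule sum.swap)
  also have "\<dots> = (\<Sum>j\<in>range blk. ?x j \<bullet> (D *v ?x j))"
  proof (intro sum.cong refl)
    fix j
    assume "j \<in> range blk"
    have "(\<Sum>k\<in>range blk. ?x j \<bullet> (D *v ?x k)) = (\<Sum>k\<in>range blk. if k = j then ?x j \<bullet> (D *v ?x j) else 0)"
      by (intro sum.cong refl) (auto simp: cross)
    also have "\<dots> = ?x j \<bullet> (D *v ?x j)"
      using \<open>j \<in> range blk\<close> by simp
    finally show "(\<Sum>k\<in>range blk. ?x j \<bullet> (D *v ?x k)) = ?x j \<bullet> (D *v ?x j)" .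
  qed
  finally show ?thesis .
qed

lemma symmetric_mat_of_blocks:
  assumes "block_diag blk D" and "\<forall>j. block_symmetric blk j D"
  shows "symmetric_mat D"
proof -
  have "D $ q $ p = D $ p $ q" for p q
    using assms by (cases "blk p = blk q") (auto simp: block_diag_def block_symmetric_def)
  then show ?thesis
    by (simp add: symmetric_mat_def transpose_def vec_eq_iff)
qed

lemma pos_def_of_blocks:
  fixes D :: "real^'n^'n" and blk :: "'n \<Rightarrow> 'k"
  assumes "block_diag blk D" and "\<forall>j. block_pos_def blk j D"
  shows "pos_def D"
  unfolding pos_def_def
proof (intro allI impI)
  fix x :: "real^'n"
  assume "x \<noteq> 0"
  let ?x = "\<lambda>j. block_restrict blk j x"
  have pos: "?x j \<bullet> (D *v ?x j) > 0" if "?x j \<noteq> 0" for j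
  proof -
    have "\<forall>p. blk p \<noteq> j \<longrightarrow> ?x j $ p = 0"
      by (simp add: block_restrict_def)
    then show ?thesis
      using assms(2) that unfolding block_pos_def_def by blast
  qed
  then have nonneg: "?x j \<bullet> (D *v ?x j) \<ge> 0" for j
    by (cases "?x j = 0") (auto intro: less_imp_le)
  obtain p where "x $ p \<noteq> 0"
    using \<open>x \<noteq> 0\<close> by (auto simp: vec_eq_iff)
  then have "?x (blk p) \<noteq> 0"
    by (auto simp: block_restrict_def vec_eq_iff)
  then have "(\<Sum>j\<in>range blk. ?x j \<bullet> (D *v ?x j)) > 0"
    using pos nonneg by (intro sum_pos2[OF finite_imageI[OF finite_class.finite_UNIV], of "blk p"]) auto
  then show "x \<bullet> (D *v x) > 0"
    by (simp only: quadratic_form_block_diag[OF assms(1), of x])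
qed

lemma symmetric_mat_add:
  assumes "symmetric_mat A" and "symmetric_mat B"
  shows "symmetric_mat (A + B)"
  using assms by (simp add: symmetric_mat_def transpose_def vec_eq_iff)

lemma symmetric_mat_matrix_inv:
  assumes "invertible A" and "symmetric_mat A"
  shows "symmetric_mat (matrix_inv A)"
  using assms by (simp add: symmetric_mat_def transpose_matrix_inv)

lemma succ_mat_add_left: "succ_mat X Y \<Longrightarrow> succ_mat (Z + X) (Z + Y)"
  by (simp add: succ_mat_def)

lemma succ_mat_congruence:
  fixes A :: "real^'n^'m" and X Y :: "real^'m^'m"
  assumes "succ_mat X Y" and "inj ((*v) A)"
  shows "succ_mat (transpose A ** X ** A) (transpose A ** Y ** A)"
proof -
  have "pos_def (transpose A ** (X - Y) ** A)"
    using assms by (simp add: succ_mat_def pos_def_congruence)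
  then show ?thesis
    by (simp add: succ_mat_def pos_def_def inner_congruence_matrix_vector
        matrix_vector_mult_diff_rdistrib inner_diff_right)
qed

lemma pos_def_of_succ_mat: "succ_mat X Y \<Longrightarrow> pos_def Y \<Longrightarrow> pos_def X"
  using pos_def_add[of "X - Y" Y] by (simp add: succ_mat_def)

lemma false_alarm_unaware_factor:
  fixes Sz P L :: "real^'m^'m"
  assumes "invertible L" and "L ** transpose L = Sz + P"
  shows "false_alarm_unaware Sz P \<tau>
       = measure (gaussian_measure (mat 1)) {u. \<tau> < (L *v u) \<bullet> (matrix_inv Sz *v (L *v u))}"
proof -
  have [measurable]: "{z. \<tau> < z \<bullet> (matrix_inv Sz *v z)} \<in> sets borel"
    by (intro borel_open open_Collect_less continuous_intros)
  have "false_alarm_unaware Sz P \<tau>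
      = measure (distr (gaussian_measure (mat 1)) borel ((*v) L)) {z. \<tau> < z \<bullet> (matrix_inv Sz *v z)}"
    using gaussian_measure_linear_image[OF assms(1)] by (simp add: false_alarm_unaware_def assms(2))
  then show ?thesis
    by (simp add: measure_distr gaussian_measure_def vimage_def)
qed

lemma false_alarm_unaware_whitened:
  fixes Sz P W :: "real^'m^'m"
  assumes W: "symmetric_mat W" "pos_def W" "W ** W = Sz"
    and S: "symmetric_mat (Sz + P)" "pos_def (Sz + P)"
  shows "false_alarm_unaware Sz P \<tau>
       = measure (gaussian_measure (mat 1))
           {u. \<tau> < u \<bullet> ((matrix_inv W ** (Sz + P) ** matrix_inv W) *v u)}"
proof -
  let ?Wi = "matrix_inv W"
  define T where "T = ?Wi ** (Sz + P) ** ?Wi"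
  have "invertible W"
    using W(2) by (rule pos_def_imp_invertible)
  then have "invertible ?Wi" and Wi_W: "?Wi ** W = mat 1" and W_Wi: "W ** ?Wi = mat 1"
    and "transpose ?Wi = ?Wi"
    using W(1) symmetric_mat_matrix_inv
    by (simp_all add: invertible_matrix_inv matrix_inv_left matrix_inv_right symmetric_mat_def)
  then obtain R where R: "symmetric_mat R" "pos_def R" "R ** R = T"
    using pos_def_sqrt symmetric_mat_congruence[OF S(1)] pos_def_congruence[OF S(2)]
      inj_matrix_vector_mult unfolding T_def by metis
  define L where "L = W ** R"
  have "L ** transpose L = W ** (R ** R) ** W"
    using W(1) R(1) by (simp add: L_def symmetric_mat_def matrix_transpose_mul matrix_mul_assoc)
  also have "\<dots> = (W ** ?Wi) ** (Sz + P) ** (?Wi ** W)"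
    by (simp add: R(3) T_def matrix_mul_assoc)
  finally have "L ** transpose L = Sz + P"
    by (simp add: Wi_W W_Wi)
  moreover have "invertible L"
    unfolding L_def using \<open>invertible W\<close> pos_def_imp_invertible[OF R(2)] by (rule invertible_mult)
  moreover have "(L *v u) \<bullet> (matrix_inv Sz *v (L *v u)) = u \<bullet> (T *v u)" for u
  proof -
    have Wi_W_vec: "?Wi *v (W *v y) = y" and W_Wi_vec: "W *v (?Wi *v y) = y" for y
      by (simp_all only: matrix_vector_mul_assoc Wi_W W_Wi matrix_vector_mul_lid)
    have "matrix_inv Sz = ?Wi ** ?Wi"
      using \<open>invertible W\<close> W(3) by (simp flip: matrix_inv_mult)
    then have "(L *v u) \<bullet> (matrix_inv Sz *v (L *v u)) = (W *v (R *v u)) \<bullet> (?Wi *v (R *v u))"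
      by (simp only: L_def matrix_vector_mul_assoc[symmetric] Wi_W_vec)
    also have "\<dots> = (R *v u) \<bullet> (W *v (?Wi *v (R *v u)))"
      by (rule symmetric_mat_inner_commute[OF W(1), symmetric])
    also have "\<dots> = u \<bullet> (R *v (R *v u))"
      unfolding W_Wi_vec by (rule symmetric_mat_inner_commute[OF R(1), symmetric])
    finally show ?thesis
      by (simp only: matrix_vector_mul_assoc R(3))
  qed
  ultimately show ?thesis
    by (simp add: false_alarm_unaware_factor T_def)
qed

lemma false_alarm_unaware_strict_mono:
  fixes Sz Pa Pb :: "real^'m^'m"
  assumes "\<tau> > 0" and "symmetric_mat Sz" and "pos_def Sz"
    and "symmetric_mat Pa" and "symmetric_mat Pb" and "pos_def (Sz + Pb)" and "succ_mat Pa Pb"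
  shows "false_alarm_unaware Sz Pb \<tau> < false_alarm_unaware Sz Pa \<tau>"
proof -
  obtain W where W: "symmetric_mat W" "pos_def W" "W ** W = Sz"
    using pos_def_sqrt[OF assms(2,3)] by blast
  let ?Wi = "matrix_inv W"
  have "invertible W"
    using W(2) by (rule pos_def_imp_invertible)
  then have Wi: "inj ((*v) ?Wi)" "transpose ?Wi ** X ** ?Wi = ?Wi ** X ** ?Wi" for X
    using symmetric_mat_matrix_inv[OF _ W(1)]
    by (simp_all add: invertible_matrix_inv inj_matrix_vector_mult symmetric_mat_def)
  have "succ_mat (Sz + Pa) (Sz + Pb)"
    using assms(7) by (rule succ_mat_add_left)
  then have "pos_def (Sz + Pa)"
    using assms(6) by (rule pos_def_of_succ_mat)
  show ?thesis
    using measure_gaussian_quadratic_tail_less[OF assms(1) pos_def_congruence[OF assms(6) Wi(1)]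
        succ_mat_congruence[OF \<open>succ_mat (Sz + Pa) (Sz + Pb)\<close> Wi(1)]]
    unfolding Wi(2)
      false_alarm_unaware_whitened[OF W symmetric_mat_add[OF assms(2,4)] \<open>pos_def (Sz + Pa)\<close>]
      false_alarm_unaware_whitened[OF W symmetric_mat_add[OF assms(2,5)] assms(6)] .
qed

theorem corollary1:
  fixes \<tau> :: real
    and Sz :: "real^'m^'m"
    and M :: "real^'n^'m"
    and blk :: "'n \<Rightarrow> 'k"
    and Da Db :: "real^'n^'n"
  assumes tau_pos: "\<tau> > 0"
    and Sz_sym: "symmetric_mat Sz"
    and Sz_pd: "pos_def Sz"
    and M_rank: "rank M = CARD('m)"
    and Da_bd: "block_diag blk Da"
    and Db_bd: "block_diag blk Db"
    and Da_sym: "\<forall>j. block_symmetric blk j Da"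
    and Db_sym: "\<forall>j. block_symmetric blk j Db"
    and ab: "\<forall>j. block_pos_def blk j (Da - Db)"
    and b_pd: "\<forall>j. block_pos_def blk j Db"
    and comm_a: "(M ** Da ** transpose M) ** matrix_inv Sz = matrix_inv Sz ** (M ** Da ** transpose M)"
    and comm_b: "(M ** Db ** transpose M) ** matrix_inv Sz = matrix_inv Sz ** (M ** Db ** transpose M)"
  shows "false_alarm_unaware Sz (M ** Da ** transpose M) \<tau>
         > false_alarm_unaware Sz (M ** Db ** transpose M) \<tau>"
proof (rule false_alarm_unaware_strict_mono[OF tau_pos Sz_sym Sz_pd])
  have MT: "inj ((*v) (transpose M))"
    "transpose (transpose M) ** D ** transpose M = M ** D ** transpose M" for D using M_rank by (simp_all add: full_rank_injective[symmetric] rank_transpose)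
  show "symmetric_mat (M ** Da ** transpose M)" "symmetric_mat (M ** Db ** transpose M)"
    using symmetric_mat_congruence[OF symmetric_mat_of_blocks, of blk _ "transpose M"]
      Da_bd Da_sym Db_bd Db_sym by (simp_all only: MT(2))
  show "pos_def (Sz + M ** Db ** transpose M)"
    using pos_def_add[OF Sz_pd pos_def_congruence[OF pos_def_of_blocks[OF Db_bd b_pd] MT(1)]]
    by (simp only: MT(2))
  have "succ_mat Da Db"
    using pos_def_of_blocks[of blk "Da - Db"] Da_bd Db_bd ab by (simp add: succ_mat_def block_diag_def)
  then show "succ_mat (M ** Da ** transpose M) (M ** Db ** transpose M)"
    using succ_mat_congruence[OF _ MT(1)] by (simp only: MT(2))
qed

end
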